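(* For every integer $n\geq 0$, the Lucas-Leonardo quaternion $\mathbb{Q}\mathcal{R}_{n}$ is invertible in the quaternion algebra $\mathbb{Q}_{\mathbb{Z}_{5}}$.
   Context: The Lucas-Leonardo numbers are defined by $\mathcal{R}_{0}=3$, $\mathcal{R}_{1}=1$, $\mathcal{R}_{n}=\mathcal{R}_{n-1}+\mathcal{R}_{n-2}+1$ for $n\geq 2$. For an odd prime $q$, let $\mathbb{Z}_q$ be the field with $q$ elements and $\mathbb{Q}_{\mathbb{Z}_{q}}$ the quaternion algebra over $\mathbb{Z}_q$ with basis $1,i,j,k$ and relations $i^{2}=j^{2}=-1$, $ij=-ji=k$. The $n$-th Lucas-Leonardo quaternion is $\mathbb{Q}\mathcal{R}_{n}=\mathcal{R}_{n}+\mathcal{R}_{n+1}i+\mathcal{R}_{n+2}j+\mathcal{R}_{n+3}k$, regarded as an element of $\mathbb{Q}_{\mathbb{Z}_{q}}$ by reducing its coefficients modulo $q$. *)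

theory Defs
  imports "HOL-Number_Theory.Residues" "HOL-Algebra.Module"
begin

fun lucas_leonardo :: "nat \<Rightarrow> int" where
  "lucas_leonardo 0 = 3"
| "lucas_leonardo (Suc 0) = 1"
| "lucas_leonardo (Suc (Suc n)) = lucas_leonardo (Suc n) + lucas_leonardo n + 1"

(* Quat a b c d stands for a + b i + c j + d k. *)
datatype 'a quat = Quat 'a 'a 'a 'a

fun quat_add :: "('a, 'm) ring_scheme \<Rightarrow> 'a quat \<Rightarrow> 'a quat \<Rightarrow> 'a quat" where
  "quat_add R (Quat a b c d) (Quat a' b' c' d') =
     Quat (a \<oplus>\<^bsub>R\<^esub> a') (b \<oplus>\<^bsub>R\<^esub> b') (c \<oplus>\<^bsub>R\<^esub> c') (d \<oplus>\<^bsub>R\<^esub> d')"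

(* The bilinear extension of i^2 = j^2 = -1, ij = -ji = k; by associativity these force
   k^2 = -1, jk = -kj = i and ki = -ik = j. *)
fun quat_mult :: "('a, 'm) ring_scheme \<Rightarrow> 'a quat \<Rightarrow> 'a quat \<Rightarrow> 'a quat" where
  "quat_mult R (Quat a b c d) (Quat a' b' c' d') =
     Quat (a \<otimes>\<^bsub>R\<^esub> a' \<ominus>\<^bsub>R\<^esub> b \<otimes>\<^bsub>R\<^esub> b' \<ominus>\<^bsub>R\<^esub> c \<otimes>\<^bsub>R\<^esub> c' \<ominus>\<^bsub>R\<^esub> d \<otimes>\<^bsub>R\<^esub> d')
          (a \<otimes>\<^bsub>R\<^esub> b' \<oplus>\<^bsub>R\<^esub> b \<otimes>\<^bsub>R\<^esub> a' \<oplus>\<^bsub>R\<^esub> c \<otimes>\<^bsub>R\<^esub> d' \<ominus>\<^bsub>R\<^esub> d \<otimes>\<^bsub>R\<^esub> c')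
          (a \<otimes>\<^bsub>R\<^esub> c' \<ominus>\<^bsub>R\<^esub> b \<otimes>\<^bsub>R\<^esub> d' \<oplus>\<^bsub>R\<^esub> c \<otimes>\<^bsub>R\<^esub> a' \<oplus>\<^bsub>R\<^esub> d \<otimes>\<^bsub>R\<^esub> b')
          (a \<otimes>\<^bsub>R\<^esub> d' \<oplus>\<^bsub>R\<^esub> b \<otimes>\<^bsub>R\<^esub> c' \<ominus>\<^bsub>R\<^esub> c \<otimes>\<^bsub>R\<^esub> b' \<oplus>\<^bsub>R\<^esub> d \<otimes>\<^bsub>R\<^esub> a')"

fun quat_smult :: "('a, 'm) ring_scheme \<Rightarrow> 'a \<Rightarrow> 'a quat \<Rightarrow> 'a quat" where
  "quat_smult R r (Quat a b c d) =
     Quat (r \<otimes>\<^bsub>R\<^esub> a) (r \<otimes>\<^bsub>R\<^esub> b) (r \<otimes>\<^bsub>R\<^esub> c) (r \<otimes>\<^bsub>R\<^esub> d)"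

definition quat_algebra :: "('a, 'm) ring_scheme \<Rightarrow> ('a, 'a quat) module" where
  "quat_algebra R =
     \<lparr>carrier = {Quat a b c d | a b c d.
        a \<in> carrier R \<and> b \<in> carrier R \<and> c \<in> carrier R \<and> d \<in> carrier R},
      monoid.mult = quat_mult R,
      one = Quat \<one>\<^bsub>R\<^esub> \<zero>\<^bsub>R\<^esub> \<zero>\<^bsub>R\<^esub> \<zero>\<^bsub>R\<^esub>,
      zero = Quat \<zero>\<^bsub>R\<^esub> \<zero>\<^bsub>R\<^esub> \<zero>\<^bsub>R\<^esub> \<zero>\<^bsub>R\<^esub>,
      add = quat_add R,
      smult = quat_smult R\<rparr>"

definition quat_i :: "('a, 'm) ring_scheme \<Rightarrow> 'a quat" where
  "quat_i R = Quat \<zero>\<^bsub>R\<^esub> \<one>\<^bsub>R\<^esub> \<zero>\<^bsub>R\<^esub> \<zero>\<^bsub>R\<^esub>"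

definition quat_j :: "('a, 'm) ring_scheme \<Rightarrow> 'a quat" where
  "quat_j R = Quat \<zero>\<^bsub>R\<^esub> \<zero>\<^bsub>R\<^esub> \<one>\<^bsub>R\<^esub> \<zero>\<^bsub>R\<^esub>"

definition quat_k :: "('a, 'm) ring_scheme \<Rightarrow> 'a quat" where
  "quat_k R = Quat \<zero>\<^bsub>R\<^esub> \<zero>\<^bsub>R\<^esub> \<zero>\<^bsub>R\<^esub> \<one>\<^bsub>R\<^esub>"

(* The carrier of residue_ring q is {0..q - 1}, so reduction modulo q is the operation mod q. *)
definition lucas_leonardo_quat :: "int \<Rightarrow> nat \<Rightarrow> int quat" where
  "lucas_leonardo_quat q n =
     Quat (lucas_leonardo n mod q) (lucas_leonardo (n + 1) mod q)
          (lucas_leonardo (n + 2) mod q) (lucas_leonardo (n + 3) mod q)"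

context cring
begin

lemma quat_abelian_group: "abelian_group (quat_algebra R)"
proof (rule abelian_groupI)
  fix x assume "x \<in> carrier (quat_algebra R)"
  then obtain a b c d where x: "x = Quat a b c d"
    and "a \<in> carrier R" "b \<in> carrier R" "c \<in> carrier R" "d \<in> carrier R"
    by (auto simp: quat_algebra_def)
  then show "\<exists>y\<in>carrier (quat_algebra R). y \<oplus>\<^bsub>quat_algebra R\<^esub> x = \<zero>\<^bsub>quat_algebra R\<^esub>"
    by (intro bexI[of _ "Quat (\<ominus> a) (\<ominus> b) (\<ominus> c) (\<ominus> d)"])
       (auto simp: quat_algebra_def l_neg)
qed (auto simp: quat_algebra_def a_ac)

lemma quat_ring: "ring (quat_algebra R)"
proof (rule ringI)
  show "abelian_group (quat_algebra R)" by (rule quat_abelian_group)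
  show "monoid (quat_algebra R)"
  proof (rule monoidI)
    fix x y z
    assume "x \<in> carrier (quat_algebra R)" "y \<in> carrier (quat_algebra R)" "z \<in> carrier (quat_algebra R)"
    then show "x \<otimes>\<^bsub>quat_algebra R\<^esub> y \<otimes>\<^bsub>quat_algebra R\<^esub> z
             = x \<otimes>\<^bsub>quat_algebra R\<^esub> (y \<otimes>\<^bsub>quat_algebra R\<^esub> z)"
      by (auto simp: quat_algebra_def minus_eq l_distr r_distr l_minus r_minus minus_add a_ac m_ac)
  qed (auto simp: quat_algebra_def minus_eq)
next
  fix x y z
  assume "x \<in> carrier (quat_algebra R)" "y \<in> carrier (quat_algebra R)" "z \<in> carrier (quat_algebra R)"
  then show "(x \<oplus>\<^bsub>quat_algebra R\<^esub> y) \<otimes>\<^bsub>quat_algebra R\<^esub> z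
     = x \<otimes>\<^bsub>quat_algebra R\<^esub> z \<oplus>\<^bsub>quat_algebra R\<^esub> y \<otimes>\<^bsub>quat_algebra R\<^esub> z"
    and "z \<otimes>\<^bsub>quat_algebra R\<^esub> (x \<oplus>\<^bsub>quat_algebra R\<^esub> y)
     = z \<otimes>\<^bsub>quat_algebra R\<^esub> x \<oplus>\<^bsub>quat_algebra R\<^esub> z \<otimes>\<^bsub>quat_algebra R\<^esub> y"
    by (auto simp: quat_algebra_def minus_eq l_distr r_distr l_minus r_minus minus_add a_ac m_ac)
qed

lemma quat_module: "module R (quat_algebra R)"
  by (rule moduleI[OF is_cring quat_abelian_group])
     (auto simp: quat_algebra_def l_distr r_distr m_assoc)

lemma quat_smult_mult:
  assumes "r \<in> carrier R" "x \<in> carrier (quat_algebra R)" "y \<in> carrier (quat_algebra R)"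
  shows "(r \<odot>\<^bsub>quat_algebra R\<^esub> x) \<otimes>\<^bsub>quat_algebra R\<^esub> y
           = r \<odot>\<^bsub>quat_algebra R\<^esub> (x \<otimes>\<^bsub>quat_algebra R\<^esub> y)"
    and "x \<otimes>\<^bsub>quat_algebra R\<^esub> (r \<odot>\<^bsub>quat_algebra R\<^esub> y)
           = r \<odot>\<^bsub>quat_algebra R\<^esub> (x \<otimes>\<^bsub>quat_algebra R\<^esub> y)"
  using assms by (auto simp: quat_algebra_def minus_eq l_distr r_distr l_minus r_minus minus_add a_ac m_ac)

lemma quat_relations:
  "quat_i R \<otimes>\<^bsub>quat_algebra R\<^esub> quat_i R = \<ominus>\<^bsub>quat_algebra R\<^esub> \<one>\<^bsub>quat_algebra R\<^esub>"
  "quat_j R \<otimes>\<^bsub>quat_algebra R\<^esub> quat_j R = \<ominus>\<^bsub>quat_algebra R\<^esub> \<one>\<^bsub>quat_algebra R\<^esub>"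
  "quat_i R \<otimes>\<^bsub>quat_algebra R\<^esub> quat_j R = quat_k R"
  "quat_j R \<otimes>\<^bsub>quat_algebra R\<^esub> quat_i R = \<ominus>\<^bsub>quat_algebra R\<^esub> quat_k R"
proof -
  interpret Q: ring "quat_algebra R" by (rule quat_ring)
  have neg: "\<ominus>\<^bsub>quat_algebra R\<^esub> Quat a b c d = Quat (\<ominus> a) (\<ominus> b) (\<ominus> c) (\<ominus> d)"
    if "a \<in> carrier R" "b \<in> carrier R" "c \<in> carrier R" "d \<in> carrier R" for a b c d
    using that by (intro Q.minus_equality) (auto simp: quat_algebra_def l_neg)
  have one: "\<one>\<^bsub>quat_algebra R\<^esub> = Quat \<one> \<zero> \<zero> \<zero>"
    and mult: "(\<otimes>\<^bsub>quat_algebra R\<^esub>) = quat_mult R"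
    by (simp_all add: quat_algebra_def)
  show "quat_i R \<otimes>\<^bsub>quat_algebra R\<^esub> quat_i R = \<ominus>\<^bsub>quat_algebra R\<^esub> \<one>\<^bsub>quat_algebra R\<^esub>"
    "quat_j R \<otimes>\<^bsub>quat_algebra R\<^esub> quat_j R = \<ominus>\<^bsub>quat_algebra R\<^esub> \<one>\<^bsub>quat_algebra R\<^esub>"
    "quat_i R \<otimes>\<^bsub>quat_algebra R\<^esub> quat_j R = quat_k R"
    "quat_j R \<otimes>\<^bsub>quat_algebra R\<^esub> quat_i R = \<ominus>\<^bsub>quat_algebra R\<^esub> quat_k R"
    by (simp_all add: one mult neg quat_i_def quat_j_def quat_k_def minus_eq)
qed

lemma quat_basis_expansion:
  assumes "a \<in> carrier R" "b \<in> carrier R" "c \<in> carrier R" "d \<in> carrier R"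
  shows "Quat a b c d =
    a \<odot>\<^bsub>quat_algebra R\<^esub> \<one>\<^bsub>quat_algebra R\<^esub> \<oplus>\<^bsub>quat_algebra R\<^esub>
    b \<odot>\<^bsub>quat_algebra R\<^esub> quat_i R \<oplus>\<^bsub>quat_algebra R\<^esub>
    c \<odot>\<^bsub>quat_algebra R\<^esub> quat_j R \<oplus>\<^bsub>quat_algebra R\<^esub>
    d \<odot>\<^bsub>quat_algebra R\<^esub> quat_k R"
  using assms by (simp add: quat_algebra_def quat_i_def quat_j_def quat_k_def)

end

end

theory Submission
  imports Defs
begin

text \<open>
A quaternion whose norm is a unit is itself a unit: its inverse is its conjugate divided by the
norm. So it suffices to find the norm of the Lucas-Leonardo quaternions modulo 5.

Adding 1 turns the recurrence into the Fibonacci one, whose characteristic polynomial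
$x^2 - x - 1$ is $(x - 3)^2$ modulo 5. The initial values make the term of the form $n 3^n$ vanish,
so the \<open>n\<close>-th number is congruent to $4 \cdot 3^n - 1$
(lemma \<open>lucas_leonardo_cong_5\<close>). Since 3 is a primitive root modulo 5, as \<open>u\<close> runs through
$4 \cdot 3^n, \ldots, 4 \cdot 3^{n+3}$ it meets every unit modulo 5 once. Both $\sum u$ and
$\sum u^2$ vanish, so $\sum (u - 1)^2 = 4$: the norm is the unit 4 for every \<open>n\<close>.
\<close>

context cring
begin

text \<open>
A quaternion times its conjugate, in either order, is the norm, because the mixed terms cancel.
The norm is a central scalar, so scaling the conjugate by its inverse gives a two-sided inverse.
\<close>
lemma quat_Units_if_norm_unit:
  assumes closed: "a \<in> carrier R" "b \<in> carrier R" "c \<in> carrier R" "d \<in> carrier R"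
    and norm: "a \<otimes> a \<oplus> b \<otimes> b \<oplus> c \<otimes> c \<oplus> d \<otimes> d \<in> Units R" (is "?N \<in> _")
  shows "Quat a b c d \<in> Units (quat_algebra R)"
proof -
  let ?Q = "quat_algebra R"
  interpret Q: ring ?Q by (rule quat_ring)
  interpret Q: module R ?Q by (rule quat_module)
  define x where "x = Quat a b c d"
  define y where "y = Quat a (\<ominus> b) (\<ominus> c) (\<ominus> d)"
  define v where "v = inv ?N"
  have x: "x \<in> carrier ?Q" and y: "y \<in> carrier ?Q"
    using closed by (auto simp: x_def y_def quat_algebra_def)
  have v: "v \<in> carrier R" and vN: "v \<otimes> ?N = \<one>"
    using norm by (simp_all add: v_def Units_l_inv)
  have cancel: "p \<oplus> (q \<oplus> (\<ominus> p \<oplus> \<ominus> q)) = \<zero>" if "p \<in> carrier R" "q \<in> carrier R" for p q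
    using that r_neg[of "p \<oplus> q"] by (simp add: minus_add a_assoc)
  have xy: "x \<otimes>\<^bsub>?Q\<^esub> y = ?N \<odot>\<^bsub>?Q\<^esub> \<one>\<^bsub>?Q\<^esub>"
    and yx: "y \<otimes>\<^bsub>?Q\<^esub> x = ?N \<odot>\<^bsub>?Q\<^esub> \<one>\<^bsub>?Q\<^esub>"
    using closed
    by (simp_all add: x_def y_def quat_algebra_def minus_eq l_minus r_minus a_ac m_ac
        r_neg r_neg1 r_neg2 cancel)
  have scale: "v \<odot>\<^bsub>?Q\<^esub> (?N \<odot>\<^bsub>?Q\<^esub> \<one>\<^bsub>?Q\<^esub>) = \<one>\<^bsub>?Q\<^esub>"
    using closed v vN by (simp flip: Q.smult_assoc1)
  have "x \<otimes>\<^bsub>?Q\<^esub> (v \<odot>\<^bsub>?Q\<^esub> y) = \<one>\<^bsub>?Q\<^esub>"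
    using quat_smult_mult(2)[OF v x y] xy scale by simp
  moreover have "(v \<odot>\<^bsub>?Q\<^esub> y) \<otimes>\<^bsub>?Q\<^esub> x = \<one>\<^bsub>?Q\<^esub>"
    using quat_smult_mult(1)[OF v y x] yx scale by simp
  moreover have "v \<odot>\<^bsub>?Q\<^esub> y \<in> carrier ?Q"
    using v y by simp
  ultimately show ?thesis
    using x unfolding Units_def x_def by blast
qed

end

lemma lucas_leonardo_cong_5: "[lucas_leonardo n = 4 * 3 ^ n - 1] (mod 5)"
proof (induction n rule: lucas_leonardo.induct)
  case (3 n)
  have "[lucas_leonardo (Suc n) + lucas_leonardo n + 1
      = (4 * 3 ^ Suc n - 1) + (4 * 3 ^ n - 1) + 1] (mod 5)"
    by (intro cong_add 3 cong_refl)
  \<comment> \<open>This is where $3^2 = 3 + 1$ modulo 5 enters.\<close>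
  also have "[(4 * 3 ^ Suc n - 1) + (4 * 3 ^ n - 1) + 1 = 4 * 3 ^ Suc (Suc n) - (1::int)] (mod 5)"
    by (simp add: cong_iff_dvd_diff)
  finally show ?case by simp
qed (simp_all add: cong_def)

lemma lucas_leonardo_norm_cong_5:
  "[lucas_leonardo n * lucas_leonardo n + lucas_leonardo (n + 1) * lucas_leonardo (n + 1)
    + lucas_leonardo (n + 2) * lucas_leonardo (n + 2)
    + lucas_leonardo (n + 3) * lucas_leonardo (n + 3) = 4] (mod 5)"
  (is "[?N = 4] (mod 5)")
proof -
  let ?r = "\<lambda>m. 4 * 3 ^ m - (1::int)"
  have "[?N = ?r n * ?r n + ?r (n + 1) * ?r (n + 1) + ?r (n + 2) * ?r (n + 2)
      + ?r (n + 3) * ?r (n + 3)] (mod 5)"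
    by (intro cong_add cong_mult lucas_leonardo_cong_5)
  \<comment> \<open>The sums over the four units are the geometric sums $1 + 3 + 9 + 27 = 40$ and
    $1 + 9 + 81 + 729 = 820$, both divisible by 5.\<close>
  also have "?r n * ?r n + ?r (n + 1) * ?r (n + 1) + ?r (n + 2) * ?r (n + 2)
      + ?r (n + 3) * ?r (n + 3) = 4 + 5 * (16 * 164 * (3 ^ n * 3 ^ n) - 64 * 3 ^ n)"
    by (simp add: power_add algebra_simps)
  also have "[\<dots> = 4] (mod 5)"
    by (simp add: cong_iff_dvd_diff)
  finally show ?thesis .
qed

theorem proposition6:
  fixes n :: nat
  shows "lucas_leonardo_quat 5 n \<in> Units (quat_algebra (residue_ring 5))"
proof -
  interpret residues 5 "residue_ring 5"
    by unfold_locales simp_all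
  have "4 \<in> Units (residue_ring 5)"
    by (simp add: res_units_eq coprime_iff_gcd_eq_1 gcd_non_0_int)
  then show ?thesis
    unfolding lucas_leonardo_quat_def
    using lucas_leonardo_norm_cong_5[of n]
    by (intro quat_Units_if_norm_unit) (simp_all add: mod_in_carrier mult_cong add_cong cong_def)
qed

end
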